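(* Let $M$ be an abelian group (regarded as a $\mathbb{Z}$-module). The following statements are equivalent. (1) $M$ is simple-direct-projective. (2) Both of the following hold: (a) the torsion submodule $T(M)$ is simple-direct-projective; and (b) for each prime $p$ such that $pM+T(M)\neq M$, one has $\mathrm{soc}(T_p(M))\subseteq \mathrm{rad}(T_p(M))$.
   Context: A module $M$ is simple-direct-projective if, whenever $A$ and $B$ are submodules of $M$ with $B$ simple, $M/A\cong B$ and $B$ a direct summand of $M$, then $A$ is a direct summand of $M$. For an abelian group $M$, $T(M)$ is its torsion subgroup and, for a prime $p$, $T_p(M)=\{m\in T(M): p^n m=0 \text{ for some } n\ge 1\}$ is its $p$-primary component. $\mathrm{soc}(X)$ is the sum of all simple submodules of $X$; $\mathrm{rad}(X)$ (the Jacobson radical of $X$) is the intersection of all maximal submodules of $X$, with $\mathrm{rad}(X)=X$ if $X$ has no maximal submodules. *)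

theory Defs
  imports "HOL-Algebra.Algebra"
begin

text \<open>
  Modules are those of HOL-Algebra. A submodule \<open>H\<close> of \<open>M\<close> is a carrier set; regarded as a module
  in its own right it is \<open>M\<lparr>carrier := H\<rparr>\<close>. An abelian group is a module over the ring of integers.
\<close>

text \<open>
  The module record inherits the fields \<open>mult\<close> and \<open>one\<close> from rings; they play no role in modules
  and are left undefined. Scalar multiplication sends the coset of \<open>x\<close> to the coset of \<open>r x\<close>.
\<close>

definition quotient_module ::
    "('r, 'a, 'm) module_scheme \<Rightarrow> 'a set \<Rightarrow> ('r, 'a set) module"
  where "quotient_module M A =
    \<lparr>carrier = a_rcosets\<^bsub>M\<^esub> A, monoid.mult = undefined, one = undefined,
     ring.zero = A, ring.add = (\<lambda>U V. U <+>\<^bsub>M\<^esub> V),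
     smult = (\<lambda>r U. \<Union>x\<in>U. A +>\<^bsub>M\<^esub> (r \<odot>\<^bsub>M\<^esub> x))\<rparr>"

lemma quotient_smult:
  assumes "Module.module R M" "submodule A R M" "r \<in> carrier R" "x \<in> carrier M"
  shows "r \<odot>\<^bsub>quotient_module M A\<^esub> (A +>\<^bsub>M\<^esub> x) = A +>\<^bsub>M\<^esub> (r \<odot>\<^bsub>M\<^esub> x)"
proof -
  interpret Module.module R M by fact
  interpret A: submodule A R M by fact
  interpret AS: abelian_subgroup A M
    by (metis A.subgroup_axioms abelian_group_axioms abelian_subgroupI3 additive_subgroupI)
  have A: "A \<subseteq> carrier M" using A.subset by simp
  have "A +>\<^bsub>M\<^esub> (r \<odot>\<^bsub>M\<^esub> y) = A +>\<^bsub>M\<^esub> (r \<odot>\<^bsub>M\<^esub> x)" if y: "y \<in> A +>\<^bsub>M\<^esub> x" for y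
  proof -
    obtain a where a: "a \<in> A" "y = a \<oplus>\<^bsub>M\<^esub> x" using y by (auto simp: a_r_coset_def')
    then have "r \<odot>\<^bsub>M\<^esub> y = r \<odot>\<^bsub>M\<^esub> a \<oplus>\<^bsub>M\<^esub> r \<odot>\<^bsub>M\<^esub> x" using A assms smult_r_distr by auto
    then have "r \<odot>\<^bsub>M\<^esub> y \<in> A +>\<^bsub>M\<^esub> (r \<odot>\<^bsub>M\<^esub> x)" using a assms by (auto simp: a_r_coset_def')
    then show ?thesis using a_repr_independence[of "r \<odot>\<^bsub>M\<^esub> y" A "r \<odot>\<^bsub>M\<^esub> x"] assms A.subgroup_axioms by auto
  qed
  moreover have "x \<in> A +>\<^bsub>M\<^esub> x" using assms AS.a_rcos_self by simp
  ultimately have "(\<Union>y\<in>A +>\<^bsub>M\<^esub> x. A +>\<^bsub>M\<^esub> (r \<odot>\<^bsub>M\<^esub> y)) = A +>\<^bsub>M\<^esub> (r \<odot>\<^bsub>M\<^esub> x)" by blast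
  then show ?thesis by (simp add: quotient_module_def)
qed

definition module_hom ::
    "('r, 's) ring_scheme \<Rightarrow> ('r, 'a, 'm) module_scheme \<Rightarrow> ('r, 'b, 'n) module_scheme \<Rightarrow> ('a \<Rightarrow> 'b) set"
  where "module_hom R M N =
    {f \<in> hom (add_monoid M) (add_monoid N).
      \<forall>r\<in>carrier R. \<forall>x\<in>carrier M. f (r \<odot>\<^bsub>M\<^esub> x) = r \<odot>\<^bsub>N\<^esub> f x}"

definition module_isomorphic ::
    "('r, 's) ring_scheme \<Rightarrow> ('r, 'a, 'm) module_scheme \<Rightarrow> ('r, 'b, 'n) module_scheme \<Rightarrow> bool"
  where "module_isomorphic R M N \<longleftrightarrow>
    (\<exists>f\<in>module_hom R M N. bij_betw f (carrier M) (carrier N))"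

definition simple_submodule ::
    "'a set \<Rightarrow> ('r, 's) ring_scheme \<Rightarrow> ('r, 'a, 'm) module_scheme \<Rightarrow> bool"
  where "simple_submodule B R M \<longleftrightarrow>
    submodule B R M \<and> B \<noteq> {\<zero>\<^bsub>M\<^esub>} \<and>
    (\<forall>H. submodule H R M \<and> H \<subseteq> B \<longrightarrow> H = {\<zero>\<^bsub>M\<^esub>} \<or> H = B)"

definition maximal_submodule ::
    "'a set \<Rightarrow> ('r, 's) ring_scheme \<Rightarrow> ('r, 'a, 'm) module_scheme \<Rightarrow> bool"
  where "maximal_submodule N R M \<longleftrightarrow>
    submodule N R M \<and> N \<noteq> carrier M \<and>
    (\<forall>H. submodule H R M \<and> N \<subseteq> H \<longrightarrow> H = N \<or> H = carrier M)"

definition direct_summand ::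
    "'a set \<Rightarrow> ('r, 's) ring_scheme \<Rightarrow> ('r, 'a, 'm) module_scheme \<Rightarrow> bool"
  where "direct_summand A R M \<longleftrightarrow>
    submodule A R M \<and>
    (\<exists>C. submodule C R M \<and> A <+>\<^bsub>M\<^esub> C = carrier M \<and> A \<inter> C = {\<zero>\<^bsub>M\<^esub>})"

definition simple_direct_projective ::
    "('r, 's) ring_scheme \<Rightarrow> ('r, 'a, 'm) module_scheme \<Rightarrow> bool"
  where "simple_direct_projective R M \<longleftrightarrow>
    (\<forall>A B. submodule A R M \<and> simple_submodule B R M \<and>
       module_isomorphic R (quotient_module M A) (M\<lparr>carrier := B\<rparr>) \<and>
       direct_summand B R M \<longrightarrow> direct_summand A R M)"

text \<open>
  The sum of a possibly infinite family of submodules consists of the finite sums of elements taken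
  from members of the family; the empty family has sum \<open>{\<zero>}\<close>.
\<close>

definition sum_of_submodules :: "('r, 'a, 'm) module_scheme \<Rightarrow> 'a set set \<Rightarrow> 'a set"
  where "sum_of_submodules M \<S> =
    {finsum M f F | f F. finite F \<and> F \<subseteq> \<S> \<and> (\<forall>B\<in>F. f B \<in> B)}"

definition socle :: "('r, 's) ring_scheme \<Rightarrow> ('r, 'a, 'm) module_scheme \<Rightarrow> 'a set"
  where "socle R M = sum_of_submodules M {B. simple_submodule B R M}"

text \<open>Intersecting with the carrier gives the whole module if there are no maximal submodules.\<close>

definition jacobson_radical :: "('r, 's) ring_scheme \<Rightarrow> ('r, 'a, 'm) module_scheme \<Rightarrow> 'a set"
  where "jacobson_radical R M = carrier M \<inter> \<Inter>{N. maximal_submodule N R M}"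

definition torsion :: "(int, 'a, 'm) module_scheme \<Rightarrow> 'a set"
  where "torsion M = {m \<in> carrier M. \<exists>n::int. n \<noteq> 0 \<and> n \<odot>\<^bsub>M\<^esub> m = \<zero>\<^bsub>M\<^esub>}"

lemma torsion_submodule:
  assumes "Module.module \<Z> M" shows "submodule (torsion M) \<Z> M"
proof -
  interpret Module.module \<Z> M by fact
  show ?thesis
  proof (rule submoduleI)
    fix a assume "a \<in> torsion M"
    then obtain n where n: "a \<in> carrier M" "n \<noteq> 0" "n \<odot>\<^bsub>M\<^esub> a = \<zero>\<^bsub>M\<^esub>" by (auto simp: torsion_def)
    then have "n \<odot>\<^bsub>M\<^esub> (\<ominus>\<^bsub>M\<^esub> a) = \<zero>\<^bsub>M\<^esub>" using smult_r_minus[of n a] by simp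
    with n show "\<ominus>\<^bsub>M\<^esub> a \<in> torsion M" by (auto simp: torsion_def)
  next
    fix a b assume "a \<in> torsion M" "b \<in> torsion M"
    then obtain n where n: "a \<in> carrier M" "n \<noteq> 0" "n \<odot>\<^bsub>M\<^esub> a = \<zero>\<^bsub>M\<^esub>" by (auto simp: torsion_def)
    from \<open>b \<in> torsion M\<close>
    obtain k where k: "b \<in> carrier M" "k \<noteq> 0" "k \<odot>\<^bsub>M\<^esub> b = \<zero>\<^bsub>M\<^esub>" by (auto simp: torsion_def)
    have "(k * n) \<odot>\<^bsub>M\<^esub> a = \<zero>\<^bsub>M\<^esub>" "(n * k) \<odot>\<^bsub>M\<^esub> b = \<zero>\<^bsub>M\<^esub>"
      using smult_assoc1[of k n a] smult_assoc1[of n k b] n k smult_r_null by auto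
    then have "(n * k) \<odot>\<^bsub>M\<^esub> (a \<oplus>\<^bsub>M\<^esub> b) = \<zero>\<^bsub>M\<^esub>"
      using smult_r_distr[of "n*k" a b] n k by (simp add: mult.commute)
    with n k show "a \<oplus>\<^bsub>M\<^esub> b \<in> torsion M" by (auto simp: torsion_def intro!: exI[of _ "n*k"])
  next
    fix r x assume "x \<in> torsion M"
    then obtain n where n: "x \<in> carrier M" "n \<noteq> 0" "n \<odot>\<^bsub>M\<^esub> x = \<zero>\<^bsub>M\<^esub>" by (auto simp: torsion_def)
    have "n \<odot>\<^bsub>M\<^esub> (r \<odot>\<^bsub>M\<^esub> x) = r \<odot>\<^bsub>M\<^esub> (n \<odot>\<^bsub>M\<^esub> x)"
      using smult_assoc1[of n r x] smult_assoc1[of r n x] n by (simp add: mult.commute)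
    with n show "r \<odot>\<^bsub>M\<^esub> x \<in> torsion M" by (auto simp: torsion_def)
  next
    show "torsion M \<subseteq> carrier M" by (auto simp: torsion_def)
  next
    have "(1::int) \<noteq> 0 \<and> 1 \<odot>\<^bsub>M\<^esub> \<zero>\<^bsub>M\<^esub> = \<zero>\<^bsub>M\<^esub>" using smult_r_null[of 1] by simp
    then show "\<zero>\<^bsub>M\<^esub> \<in> torsion M" unfolding torsion_def mem_Collect_eq by (meson M.zero_closed)
  qed
qed

definition primary_component :: "(int, 'a, 'm) module_scheme \<Rightarrow> nat \<Rightarrow> 'a set"
  where "primary_component M p =
    {m \<in> torsion M. \<exists>n::nat. n \<ge> 1 \<and> (int p ^ n) \<odot>\<^bsub>M\<^esub> m = \<zero>\<^bsub>M\<^esub>}"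

definition multiples :: "(int, 'a, 'm) module_scheme \<Rightarrow> nat \<Rightarrow> 'a set"
  where "multiples M p = (\<lambda>m. int p \<odot>\<^bsub>M\<^esub> m) ` carrier M"

end

theory Submission
  imports Defs
begin

text \<open>
  A simple subgroup of order \<open>p\<close> is a summand iff it is not contained in \<open>pM\<close>, and a subgroup \<open>A\<close>
  of index \<open>p\<close> (so \<open>pM \<subseteq> A\<close>) is a summand iff it does not contain \<open>M[p] = {x. px = 0}\<close>. As
  hyperplanes of \<open>M/pM\<close> separate points, \<open>M\<close> is simple-direct-projective iff for every prime \<open>p\<close>
  either \<open>M[p] \<subseteq> pM\<close> or \<open>M[p] + pM = M\<close>. For the torsion subgroup \<open>T\<close> one has \<open>T[p] = M[p]\<close> and
  \<open>pT = pM \<inter> T\<close>, so the criteria for \<open>M\<close> and \<open>T\<close> agree when \<open>pM + T = M\<close>. When \<open>pM + T \<noteq> M\<close> only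
  \<open>M[p] \<subseteq> pM\<close> is possible for \<open>M\<close>, and this says that the socle \<open>M[p]\<close> of \<open>T\<^sub>p\<close> lies in its radical
  \<open>pT\<^sub>p\<close>.
\<close>

section \<open>Integer scalars and submodules of an abelian group\<close>

definition torsion_by :: "(int, 'a, 'm) module_scheme \<Rightarrow> int \<Rightarrow> 'a set"
  where "torsion_by M n = {m \<in> carrier M. n \<odot>\<^bsub>M\<^esub> m = \<zero>\<^bsub>M\<^esub>}"

definition cyclic_submodule :: "(int, 'a, 'm) module_scheme \<Rightarrow> 'a \<Rightarrow> 'a set"
  where "cyclic_submodule M x = range (\<lambda>k. k \<odot>\<^bsub>M\<^esub> x)"

lemma mem_set_add_iff: "x \<in> A <+>\<^bsub>M\<^esub> B \<longleftrightarrow> (\<exists>a\<in>A. \<exists>b\<in>B. x = a \<oplus>\<^bsub>M\<^esub> b)"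
  by (auto simp: set_add_def')

text \<open>Every integer lies in the carrier of \<open>\<Z>\<close>, so fixing the ring frees the
  module laws of side conditions on scalars.\<close>

locale int_module = Module.module \<Z> M for M :: "(int, 'a, 'm) module_scheme" (structure)
begin

lemma smult_carrier [simp, intro]: "x \<in> carrier M \<Longrightarrow> k \<odot> x \<in> carrier M"
  by (rule smult_closed) auto

lemma smult_add: "x \<in> carrier M \<Longrightarrow> (k + l) \<odot> x = k \<odot> x \<oplus> l \<odot> x"
  using smult_l_distr[of k l x] by simp

lemma smult_add_right: "x \<in> carrier M \<Longrightarrow> y \<in> carrier M \<Longrightarrow> k \<odot> (x \<oplus> y) = k \<odot> x \<oplus> k \<odot> y"
  using smult_r_distr[of k x y] by simp

lemma smult_smult: "x \<in> carrier M \<Longrightarrow> k \<odot> (l \<odot> x) = (k * l) \<odot> x"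
  using smult_assoc1[of k l x] by simp

lemma zero_smult [simp]: "x \<in> carrier M \<Longrightarrow> 0 \<odot> x = \<zero>"
  using smult_l_null[of x] by simp

lemma smult_zero [simp]: "k \<odot> \<zero> = \<zero>"
  using smult_r_null[of k] by simp

lemma one_smult [simp]: "x \<in> carrier M \<Longrightarrow> 1 \<odot> x = x"
  using smult_one[of x] by simp

lemma minus_one_smult: "x \<in> carrier M \<Longrightarrow> (- 1) \<odot> x = \<ominus> x"
  using smult_add[of x "-1" 1] by (simp add: M.minus_equality)

text \<open>Negation is multiplication by -1, so closure under scalars covers it.\<close>

lemma int_submoduleI:
  assumes "H \<subseteq> carrier M" "\<zero> \<in> H" "\<And>x y. x \<in> H \<Longrightarrow> y \<in> H \<Longrightarrow> x \<oplus> y \<in> H"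
    "\<And>k x. x \<in> H \<Longrightarrow> k \<odot> x \<in> H"
  shows "submodule H \<Z> M"
  using assms minus_one_smult by (intro submoduleI) (auto, metis subsetD)

lemma submoduleD:
  assumes "submodule H \<Z> M"
  shows "H \<subseteq> carrier M" "x \<in> H \<Longrightarrow> x \<in> carrier M" "\<zero> \<in> H"
    "x \<in> H \<Longrightarrow> y \<in> H \<Longrightarrow> x \<oplus> y \<in> H" "x \<in> H \<Longrightarrow> k \<odot> x \<in> H"
proof -
  show "H \<subseteq> carrier M" "x \<in> H \<Longrightarrow> y \<in> H \<Longrightarrow> x \<oplus> y \<in> H"
    using submoduleE(1,5)[OF assms] by auto
  then show "x \<in> H \<Longrightarrow> x \<in> carrier M" by auto
  show smult: "k \<odot> x \<in> H" if "x \<in> H" for k x using submoduleE(4)[OF assms, of k x] that by auto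
  obtain x where "x \<in> H" using submoduleE(2)[OF assms] by blast
  with smult[of x 0] \<open>H \<subseteq> carrier M\<close> show "\<zero> \<in> H" by auto
qed

lemma submodule_add_cancel:
  assumes "submodule H \<Z> M" "x \<in> H" "x \<oplus> y \<in> H" "y \<in> carrier M"
  shows "y \<in> H"
proof -
  have "x \<in> carrier M" using assms submoduleD by auto
  then have "y = (- 1) \<odot> x \<oplus> (x \<oplus> y)"
    using assms(4) by (simp add: minus_one_smult M.r_neg1)
  then show ?thesis using submoduleD(4,5)[OF assms(1)] assms by metis
qed

text \<open>By Bezout \<open>u k + v l = 1\<close>, so \<open>x = u (k x) + v (l x)\<close>. Mostly
  used with \<open>l = p\<close> to cancel a scalar \<open>k\<close> prime to \<open>p\<close>
  modulo a submodule containing \<open>p x\<close>.\<close>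

lemma submodule_coprime:
  assumes H: "submodule H \<Z> M" and x: "x \<in> carrier M" and "coprime k l" "k \<odot> x \<in> H" "l \<odot> x \<in> H"
  shows "x \<in> H"
proof -
  obtain u v where "u * k + v * l = 1"
    using bezout_int[of k l] assms(3) by auto
  then have "x = u \<odot> (k \<odot> x) \<oplus> v \<odot> (l \<odot> x)"
    using x by (metis smult_add smult_smult one_smult)
  then show ?thesis using submoduleD(4,5)[OF H] assms by metis
qed

lemma coprime_primeI: "Factorial_Ring.prime (p::nat) \<Longrightarrow> \<not> int p dvd k \<Longrightarrow> coprime k (int p)"
  by (metis coprime_commute prime_imp_coprime_int prime_nat_int_transfer)

lemma submodule_trivial: "submodule {\<zero>} \<Z> M"
  by (rule int_submoduleI) auto

lemma submodule_set_add:
  assumes "submodule H \<Z> M" "submodule K \<Z> M"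
  shows "submodule (H <+>\<^bsub>M\<^esub> K) \<Z> M"
proof (rule int_submoduleI)
  note H = submoduleD[OF assms(1)] and K = submoduleD[OF assms(2)]
  show "H <+>\<^bsub>M\<^esub> K \<subseteq> carrier M" using H K by (auto simp: mem_set_add_iff)
  show "\<zero> \<in> H <+>\<^bsub>M\<^esub> K" using H K by (auto simp: mem_set_add_iff intro!: bexI[of _ \<zero>])
  show "x \<oplus> y \<in> H <+>\<^bsub>M\<^esub> K" if xy: "x \<in> H <+>\<^bsub>M\<^esub> K" "y \<in> H <+>\<^bsub>M\<^esub> K" for x y
  proof -
    obtain h k h' k' where "h \<in> H" "k \<in> K" "h' \<in> H" "k' \<in> K" "x = h \<oplus> k" "y = h' \<oplus> k'"
      using xy by (auto simp: mem_set_add_iff)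
    moreover from this have "x \<oplus> y = (h \<oplus> h') \<oplus> (k \<oplus> k')"
      using H(2) K(2) by (simp add: M.a_ac)
    ultimately show ?thesis using H(4) K(4) unfolding mem_set_add_iff by metis
  qed
  show "r \<odot> x \<in> H <+>\<^bsub>M\<^esub> K" if "x \<in> H <+>\<^bsub>M\<^esub> K" for r x
    using that H K smult_add_right unfolding mem_set_add_iff by metis
qed

lemma submodule_subset_set_add:
  assumes "submodule H \<Z> M" "submodule K \<Z> M"
  shows "H \<subseteq> H <+>\<^bsub>M\<^esub> K" "K \<subseteq> H <+>\<^bsub>M\<^esub> K"
proof -
  note H = submoduleD[OF assms(1)] and K = submoduleD[OF assms(2)]
  show "H \<subseteq> H <+>\<^bsub>M\<^esub> K"
    using H K by (force simp: mem_set_add_iff intro: bexI[of _ \<zero>])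
  show "K \<subseteq> H <+>\<^bsub>M\<^esub> K"
    using H K by (force simp: mem_set_add_iff intro: bexI[of _ \<zero>])
qed

lemma set_add_subset:
  assumes "submodule L \<Z> M" "H \<subseteq> L" "K \<subseteq> L"
  shows "H <+>\<^bsub>M\<^esub> K \<subseteq> L"
  using submoduleD(4)[OF assms(1)] assms(2,3) by (auto simp: mem_set_add_iff subset_eq)

lemma submodule_cyclic: "x \<in> carrier M \<Longrightarrow> submodule (cyclic_submodule M x) \<Z> M"
  unfolding cyclic_submodule_def
  by (rule int_submoduleI)
     (auto simp: smult_smult image_iff simp flip: smult_add intro: exI[of _ 0])

lemma mem_cyclic: "x \<in> carrier M \<Longrightarrow> x \<in> cyclic_submodule M x"
  unfolding cyclic_submodule_def by (metis one_smult rangeI)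

lemma cyclic_subset: "submodule H \<Z> M \<Longrightarrow> x \<in> H \<Longrightarrow> cyclic_submodule M x \<subseteq> H"
  by (auto simp: cyclic_submodule_def submoduleD)

lemma submodule_multiples: "submodule (multiples M p) \<Z> M"
  unfolding multiples_def
proof (rule int_submoduleI)
  fix k x assume "x \<in> (\<lambda>m. int p \<odot> m) ` carrier M"
  then show "k \<odot> x \<in> (\<lambda>m. int p \<odot> m) ` carrier M"
    by (auto simp: smult_smult mult.commute[of k]) (auto simp flip: smult_smult)
qed (auto simp flip: smult_add_right intro: image_eqI[of _ _ \<zero>])

lemma submodule_torsion_by: "submodule (torsion_by M n) \<Z> M"
proof (rule int_submoduleI)
  show "k \<odot> x \<in> torsion_by M n" if "x \<in> torsion_by M n" for k x
    using that smult_smult[of x n k] smult_smult[of x k n] by (simp add: torsion_by_def mult.commute)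
qed (auto simp: torsion_by_def smult_add_right)

section \<open>Simple submodules are cyclic of prime order\<close>

text \<open>A nonzero submodule contains some \<open>k b \<noteq> 0\<close>. Then \<open>p\<close>
  does not divide \<open>k\<close>, and \<open>b\<close> is recovered from \<open>k b\<close> and
  \<open>p b = 0\<close>.\<close>

lemma cyclic_simple:
  assumes "Factorial_Ring.prime p" "b \<in> torsion_by M (int p)" "b \<noteq> \<zero>"
  shows "simple_submodule (cyclic_submodule M b) \<Z> M"
  unfolding simple_submodule_def
proof (intro conjI allI impI)
  have b: "b \<in> carrier M" "int p \<odot> b = \<zero>" using assms by (auto simp: torsion_by_def)
  show "submodule (cyclic_submodule M b) \<Z> M" using submodule_cyclic b by simp
  show "cyclic_submodule M b \<noteq> {\<zero>}" using mem_cyclic b assms by blast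
  fix H assume H: "submodule H \<Z> M \<and> H \<subseteq> cyclic_submodule M b"
  show "H = {\<zero>} \<or> H = cyclic_submodule M b"
  proof (cases "H = {\<zero>}")
    case False
    then obtain h where "h \<in> H" "h \<noteq> \<zero>" using H submoduleD(3) by blast
    then obtain k where k: "k \<odot> b \<in> H" "k \<odot> b \<noteq> \<zero>" using H by (auto simp: cyclic_submodule_def)
    have "\<not> int p dvd k"
    proof
      assume "int p dvd k"
      then obtain l where "k = l * int p" by (metis dvdE mult.commute)
      then have "k \<odot> b = \<zero>" using b by (simp flip: smult_smult)
      with k show False by simp
    qed
    then have "b \<in> H"
      using submodule_coprime[of H b k "int p"] coprime_primeI assms(1) H k b submoduleD(3) by auto
    then show ?thesis using H cyclic_subset by blast
  qed simp
qed

lemma simple_eq_cyclic: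
  assumes "simple_submodule B \<Z> M" "b \<in> B" "b \<noteq> \<zero>"
  shows "B = cyclic_submodule M b"
proof -
  have B: "submodule B \<Z> M" using assms by (auto simp: simple_submodule_def)
  then have "b \<in> carrier M" using assms submoduleD by auto
  then show ?thesis
    using assms cyclic_subset[OF B assms(2)] submodule_cyclic[of b] mem_cyclic[of b]
    unfolding simple_submodule_def by blast
qed

lemma simple_nonzero:
  assumes "simple_submodule B \<Z> M"
  obtains b where "b \<in> B" "b \<noteq> \<zero>"
  using assms submoduleD(3) unfolding simple_submodule_def by blast

text \<open>A simple module cannot be \<open>\<Z>\<close>, as \<open>2\<Z>\<close> is a proper nonzero submodule.\<close>

lemma simple_killed_by_prime:
  assumes B: "simple_submodule B \<Z> M"
  obtains p where "Factorial_Ring.prime p" "B \<subseteq> torsion_by M (int p)"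
proof -
  have sub: "submodule B \<Z> M" using B by (auto simp: simple_submodule_def)
  obtain b where b: "b \<in> B" "b \<noteq> \<zero>" using simple_nonzero[OF B] .
  then have bM: "b \<in> carrier M" using submoduleD(2)[OF sub] by simp
  have "\<exists>n. n \<noteq> 0 \<and> n \<odot> b = \<zero>"
  proof (cases "2 \<odot> b = \<zero>")
    case False
    \<comment> \<open>If \<open>2 b\<close> is nonzero it generates \<open>B\<close>, so
      \<open>b = k (2 b)\<close>, and the odd, hence nonzero, integer \<open>2 k - 1\<close> kills
      \<open>b\<close>.\<close>
    then have "b \<in> cyclic_submodule M (2 \<odot> b)"
      using simple_eq_cyclic[OF B, of "2 \<odot> b"] b submoduleD(5)[OF sub] by auto
    then obtain k where "b = k \<odot> (2 \<odot> b)" by (auto simp: cyclic_submodule_def)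
    then have "b = (k * 2) \<odot> b" using bM by (simp add: smult_smult)
    then have "(k * 2 - 1) \<odot> b = \<zero>"
      using smult_add[OF bM, of "k * 2" "-1"] bM by (simp add: minus_one_smult M.r_neg)
    then show ?thesis by (intro exI[of _ "k * 2 - 1"]) presburger
  qed (auto intro: exI[of _ 2])
  then obtain n where n: "n \<noteq> 0" "n \<odot> b = \<zero>" by blast
  have "int (nat \<bar>n\<bar>) \<odot> b = \<zero>"
    using n bM smult_smult[of b "-1" n] by (cases "n \<ge> 0") auto
  then have ex: "\<exists>m::nat. m > 0 \<and> int m \<odot> b = \<zero>" using n(1) by (intro exI[of _ "nat \<bar>n\<bar>"]) auto
  \<comment> \<open>\<open>m\<close> is the order of \<open>b\<close>. For a prime \<open>p\<close>
    dividing \<open>m = p q\<close>, the element \<open>q b\<close> is nonzero by minimality and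
    killed by \<open>p\<close>; by simplicity it generates \<open>B\<close>.\<close>
  define m where "m = (LEAST m::nat. m > 0 \<and> int m \<odot> b = \<zero>)"
  have m: "m > 0" "int m \<odot> b = \<zero>" using LeastI_ex[OF ex] by (auto simp: m_def)
  have least: "int q \<odot> b \<noteq> \<zero>" if "0 < q" "q < m" for q
    using not_less_Least[of q "\<lambda>m. m > 0 \<and> int m \<odot> b = \<zero>"] that by (auto simp: m_def)
  have "m \<noteq> 1" using m(2) b bM by auto
  then obtain p where p: "Factorial_Ring.prime p" "p dvd m" using prime_factor_nat by blast
  then obtain q where q: "m = p * q" by blast
  then have "int q \<odot> b \<noteq> \<zero>"
    using least[of q] m(1) prime_gt_1_nat[OF p(1)] by auto
  then have "B = cyclic_submodule M (int q \<odot> b)"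
    using simple_eq_cyclic[OF B] b submoduleD(5)[OF sub] by blast
  moreover have "int q \<odot> b \<in> torsion_by M (int p)"
    using m(2) q bM by (simp add: torsion_by_def smult_smult)
  ultimately have "B \<subseteq> torsion_by M (int p)"
    using cyclic_subset[OF submodule_torsion_by] by blast
  with p(1) show ?thesis using that by blast
qed

section \<open>Hyperplanes containing \<open>pM\<close> and direct summands\<close>

text \<open>Hyperplanes of the vector space \<open>M/H\<close> over the field with \<open>p\<close>
  elements separate points: Zorn's lemma gives \<open>N\<close> maximal among the submodules that
  contain \<open>H\<close> and miss \<open>t\<close>. Every larger submodule contains
  \<open>t\<close>, and scalars prime to \<open>p\<close> are invertible modulo \<open>N\<close>, so
  \<open>N\<close> and \<open>t\<close> generate \<open>M\<close>.\<close>

lemma prime_index_submodule_avoiding: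
  assumes p: "Factorial_Ring.prime p" and H: "submodule H \<Z> M" "multiples M p \<subseteq> H"
    and t: "t \<in> carrier M" "t \<notin> H"
  obtains N where "submodule N \<Z> M" "H \<subseteq> N" "t \<notin> N" "carrier M = N <+>\<^bsub>M\<^esub> cyclic_submodule M t"
    "maximal_submodule N \<Z> M"
proof -
  define F where "F = {N. submodule N \<Z> M \<and> H \<subseteq> N \<and> t \<notin> N}"
  have "\<exists>N\<in>F. \<forall>K\<in>F. N \<subseteq> K \<longrightarrow> K = N"
  proof (rule subset_Zorn_nonempty)
    show "F \<noteq> {}" using H t by (auto simp: F_def)
    fix \<C> assume C: "\<C> \<noteq> {}" "subset.chain F \<C>"
    then have sub: "submodule K \<Z> M" if "K \<in> \<C>" for K using that by (auto simp: F_def subset_chain_def)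
    have "submodule (\<Union>\<C>) \<Z> M"
    proof (rule int_submoduleI)
      show "\<Union>\<C> \<subseteq> carrier M" using submoduleD(1)[OF sub] by (rule Union_least)
      show "\<zero> \<in> \<Union>\<C>" using submoduleD(3)[OF sub] C(1) by blast
      show "k \<odot> x \<in> \<Union>\<C>" if "x \<in> \<Union>\<C>" for k x
        using that submoduleD(5)[OF sub] by (meson Union_iff)
      fix x y assume "x \<in> \<Union>\<C>" "y \<in> \<Union>\<C>"
      then obtain K L where KL: "K \<in> \<C>" "L \<in> \<C>" "x \<in> K" "y \<in> L" by blast
      then have "K \<subseteq> L \<or> L \<subseteq> K" using C by (auto simp: subset_chain_def)
      then show "x \<oplus> y \<in> \<Union>\<C>" using KL submoduleD(4)[OF sub] by (meson UnionI subsetD)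
    qed
    then show "\<Union>\<C> \<in> F" using C by (auto simp: F_def subset_chain_def)
  qed
  then obtain N where N: "submodule N \<Z> M" "H \<subseteq> N" "t \<notin> N"
    and max: "\<And>K. submodule K \<Z> M \<Longrightarrow> t \<notin> K \<Longrightarrow> N \<subseteq> K \<Longrightarrow> K = N"
    unfolding F_def by (smt (verit) mem_Collect_eq order_trans)
  have pN: "int p \<odot> x \<in> N" if "x \<in> carrier M" for x
    using that H(2) N(2) by (auto simp: multiples_def)
  have mem: "t \<in> K" if K: "submodule K \<Z> M" "N \<subseteq> K" "K \<noteq> N" for K
    using max K by blast
  have cyc: "submodule (cyclic_submodule M t) \<Z> M" using submodule_cyclic t by simp
  have "y \<in> N <+>\<^bsub>M\<^esub> cyclic_submodule M t" if y: "y \<in> carrier M" for y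
  proof (cases "y \<in> N")
    case True
    then show ?thesis using submodule_subset_set_add(1)[OF N(1) cyc] by blast
  next
    case False
    have cy: "submodule (cyclic_submodule M y) \<Z> M" using submodule_cyclic y by simp
    have "t \<in> N <+>\<^bsub>M\<^esub> cyclic_submodule M y"
      using mem[OF submodule_set_add[OF N(1) cy]] submodule_subset_set_add[OF N(1) cy]
        mem_cyclic[OF y] False by blast
    then obtain n k where n: "n \<in> N" "t = n \<oplus> k \<odot> y"
      by (auto simp: mem_set_add_iff cyclic_submodule_def)
    have "\<not> int p dvd k"
    proof
      assume "int p dvd k"
      then have "k \<odot> y \<in> N" using pN y by (auto simp flip: smult_smult)
      then show False using n N submoduleD(4)[OF N(1)] by blast
    qed
    let ?L = "N <+>\<^bsub>M\<^esub> cyclic_submodule M t"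
    note L = submodule_set_add[OF N(1) cyc] and LN = submodule_subset_set_add[OF N(1) cyc]
    \<comment> \<open>Exchange of \<open>t\<close> and \<open>y\<close>: \<open>?L\<close> contains
      \<open>k y = t - n\<close> and also \<open>p y\<close>, and \<open>k\<close> is prime to
      \<open>p\<close>, so it contains \<open>y\<close>.\<close>
    have "k \<odot> y \<in> ?L"
      using submodule_add_cancel[OF L, of n "k \<odot> y"] n LN mem_cyclic[OF t(1)] y by auto
    then show ?thesis
      using submodule_coprime[OF L y coprime_primeI[OF p \<open>\<not> int p dvd k\<close>]] pN[OF y] LN by blast
  qed
  then have sum: "carrier M = N <+>\<^bsub>M\<^esub> cyclic_submodule M t"
    using submoduleD(1)[OF submodule_set_add[OF N(1) cyc]] by blast
  \<comment> \<open>A submodule strictly above \<open>N\<close> contains \<open>t\<close>, hence all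
    of \<open>N + \<Z>t = M\<close>.\<close>
  have "K = carrier M" if K: "submodule K \<Z> M" "N \<subseteq> K" "K \<noteq> N" for K
    using set_add_subset[OF K(1) K(2) cyclic_subset[OF K(1) mem[OF K]]] sum submoduleD(1)[OF K(1)]
    by blast
  then have "maximal_submodule N \<Z> M"
    using N t unfolding maximal_submodule_def by blast
  with N sum show ?thesis using that by blast
qed

lemma set_add_commute:
  assumes "H \<subseteq> carrier M" "K \<subseteq> carrier M"
  shows "H <+>\<^bsub>M\<^esub> K = K <+>\<^bsub>M\<^esub> H"
  using assms unfolding set_eq_iff mem_set_add_iff by (metis M.a_comm subsetD)

text \<open>Since \<open>0 \<in> A\<close>, \<open>x\<close> is nonzero and generates a simple
  submodule; its intersection with \<open>A\<close> misses \<open>x\<close> and is therefore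
  zero.\<close>

lemma cyclic_Int_trivial:
  assumes "Factorial_Ring.prime p" "x \<in> torsion_by M (int p)" "submodule A \<Z> M" "x \<notin> A"
  shows "A \<inter> cyclic_submodule M x = {\<zero>}"
proof -
  have x: "x \<in> carrier M" using assms by (auto simp: torsion_by_def)
  have "x \<noteq> \<zero>" using assms submoduleD(3) by blast
  then have "simple_submodule (cyclic_submodule M x) \<Z> M" using cyclic_simple assms by blast
  moreover have "submodule (A \<inter> cyclic_submodule M x) \<Z> M"
    using submoduleD[OF assms(3)] submoduleD[OF submodule_cyclic[OF x]]
    by (intro int_submoduleI) auto
  moreover have "A \<inter> cyclic_submodule M x \<noteq> cyclic_submodule M x" using mem_cyclic[OF x] assms(4) by blast
  ultimately show ?thesis unfolding simple_submodule_def by blast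
qed

text \<open>A hyperplane that contains \<open>pM\<close> and misses \<open>b\<close> is a complement
  of \<open>\<Z>b\<close>.\<close>

lemma direct_summand_cyclic:
  assumes p: "Factorial_Ring.prime p" and b: "b \<in> torsion_by M (int p)" "b \<notin> multiples M p"
  shows "direct_summand (cyclic_submodule M b) \<Z> M"
proof -
  have bM: "b \<in> carrier M" using b by (auto simp: torsion_by_def)
  obtain N where N: "submodule N \<Z> M" "multiples M p \<subseteq> N" "b \<notin> N"
    "carrier M = N <+>\<^bsub>M\<^esub> cyclic_submodule M b" "maximal_submodule N \<Z> M"
    using prime_index_submodule_avoiding[OF p submodule_multiples subset_refl bM b(2)] .
  have "cyclic_submodule M b \<inter> N = {\<zero>}" using cyclic_Int_trivial[OF p b(1) N(1,3)] by blast
  moreover have "cyclic_submodule M b <+>\<^bsub>M\<^esub> N = carrier M"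
    using N(4) set_add_commute submoduleD(1)[OF N(1)] submoduleD(1)[OF submodule_cyclic[OF bM]] by metis
  ultimately show ?thesis using N(1) submodule_cyclic[OF bM] unfolding direct_summand_def by blast
qed

text \<open>Write \<open>b = p y\<close> and \<open>y = b' + c\<close> along the decomposition. As
  \<open>p b' = 0\<close>, \<open>b = p c\<close> lies in the complement as well as in
  \<open>B\<close>.\<close>

lemma direct_summand_Int_multiples:
  assumes "direct_summand B \<Z> M" "B \<subseteq> torsion_by M (int p)" "b \<in> B" "b \<in> multiples M p"
  shows "b = \<zero>"
proof -
  obtain C where C: "submodule C \<Z> M" "B <+>\<^bsub>M\<^esub> C = carrier M" "B \<inter> C = {\<zero>}"
    using assms(1) by (auto simp: direct_summand_def)
  obtain y where y: "y \<in> carrier M" "b = int p \<odot> y" using assms(4) by (auto simp: multiples_def)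
  then obtain b' c where c: "b' \<in> B" "c \<in> C" "y = b' \<oplus> c" using C(2) by (metis mem_set_add_iff)
  have "b' \<in> carrier M" "int p \<odot> b' = \<zero>" using c assms(2) by (auto simp: torsion_by_def)
  then have "b = int p \<odot> c" using y c submoduleD(2)[OF C(1)] by (simp add: smult_add_right)
  then have "b \<in> C" using submoduleD(5)[OF C(1)] c by simp
  then show ?thesis using assms(3) C(3) by blast
qed

section \<open>Cosets and isomorphisms from quotients\<close>

lemma coset_eq_iff:
  assumes A: "submodule A \<Z> M" and x: "x \<in> carrier M" and y: "y \<in> carrier M"
  shows "A +> x = A +> y \<longleftrightarrow> (\<exists>a\<in>A. x = a \<oplus> y)"
proof
  have sub: "subgroup A (add_monoid M)" using A by (simp add: submodule_def)
  show "\<exists>a\<in>A. x = a \<oplus> y" if "A +> x = A +> y"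
  proof -
    have "x \<in> A +> x"
      using submoduleD(3)[OF A] x by (force simp: a_r_coset_def')
    then show ?thesis using that by (auto simp: a_r_coset_def')
  qed
  show "A +> x = A +> y" if "\<exists>a\<in>A. x = a \<oplus> y"
  proof -
    have "x \<in> A +> y" using that by (auto simp: a_r_coset_def')
    then show ?thesis using M.a_repr_independence[OF _ y sub] by simp
  qed
qed

lemma coset_eq_self_iff:
  assumes "submodule A \<Z> M" "x \<in> carrier M"
  shows "A +> x = A \<longleftrightarrow> x \<in> A"
proof -
  have "A +> \<zero> = A" using submoduleD(1)[OF assms(1)] by simp
  with coset_eq_iff[OF assms M.zero_closed] submoduleD(2)[OF assms(1)] show ?thesis by auto
qed

lemma coset_add:
  assumes "submodule A \<Z> M" "x \<in> carrier M" "y \<in> carrier M"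
  shows "(A +> x) <+>\<^bsub>M\<^esub> (A +> y) = A +> (x \<oplus> y)"
proof -
  interpret A: abelian_subgroup A M
    using assms(1) by (intro abelian_subgroupI3 additive_subgroupI M.abelian_group_axioms) (simp add: submodule_def)
  show ?thesis using A.a_rcos_sum assms by blast
qed

text \<open>Composing the isomorphism with the projection from \<open>M\<close> to
  \<open>M/A\<close> gives a homomorphism on \<open>M\<close> itself, so that later arguments need
  no cosets. Injectivity turns into kernel \<open>A\<close>, surjectivity into image
  \<open>B\<close>.\<close>

lemma quotient_isomorphism_lift:
  assumes A: "submodule A \<Z> M" and B: "submodule B \<Z> M"
    and iso: "module_isomorphic \<Z> (quotient_module M A) (M\<lparr>carrier := B\<rparr>)"
  obtains h where "\<forall>x\<in>carrier M. h x \<in> B"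
    "\<forall>x\<in>carrier M. \<forall>y\<in>carrier M. h (x \<oplus> y) = h x \<oplus> h y"
    "\<forall>k. \<forall>x\<in>carrier M. h (k \<odot> x) = k \<odot> h x"
    "\<forall>x\<in>carrier M. h x = \<zero> \<longleftrightarrow> x \<in> A"
    "B = h ` carrier M"
proof -
  let ?Q = "quotient_module M A"
  obtain f where f: "f \<in> module_hom \<Z> ?Q (M\<lparr>carrier := B\<rparr>)" "bij_betw f (carrier ?Q) B"
    using iso by (auto simp: module_isomorphic_def)
  have Q: "carrier ?Q = (\<lambda>x. A +> x) ` carrier M"
    by (auto simp: quotient_module_def A_RCOSETS_def')
  define h where "h x = f (A +> x)" for x
  have inB: "h x \<in> B" if "x \<in> carrier M" for x
    using that f(2) Q by (auto simp: h_def bij_betw_def)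
  have add: "h (x \<oplus> y) = h x \<oplus> h y" if "x \<in> carrier M" "y \<in> carrier M" for x y
  proof -
    have "f ((A +> x) <+>\<^bsub>M\<^esub> (A +> y)) = f (A +> x) \<oplus> f (A +> y)"
      using f(1) that Q by (auto simp: module_hom_def hom_def quotient_module_def)
    then show ?thesis using coset_add[OF A that] by (simp add: h_def)
  qed
  have smult: "h (k \<odot> x) = k \<odot> h x" if "x \<in> carrier M" for k x
  proof -
    have "f (k \<odot>\<^bsub>?Q\<^esub> (A +> x)) = k \<odot> f (A +> x)"
      using f(1) that Q by (auto simp: module_hom_def)
    then show ?thesis using quotient_smult[OF module_axioms A, of k x] that by (simp add: h_def)
  qed
  have zero: "h \<zero> = \<zero>"
    using smult[of \<zero> 0] inB[of \<zero>] submoduleD(2)[OF B] by simp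
  have ker: "h x = \<zero> \<longleftrightarrow> x \<in> A" if x: "x \<in> carrier M" for x
  proof -
    have "h x = h \<zero> \<longleftrightarrow> A +> x = A +> \<zero>"
      unfolding h_def using f(2) Q x by (intro inj_on_eq_iff[of f "carrier ?Q"]) (auto simp: bij_betw_def)
    then show ?thesis using coset_eq_self_iff[OF A x] zero submoduleD(1)[OF A] by simp
  qed
  have "B = h ` carrier M" using f(2) Q by (auto simp: bij_betw_def h_def)
  with inB add smult ker show ?thesis using that by blast
qed

text \<open>Both modules are cyclic of order \<open>p\<close>: \<open>k t \<in> A\<close> iff
  \<open>p\<close> divides \<open>k\<close> iff \<open>k b = 0\<close>. Hence sending the coset of
  \<open>k t\<close> to \<open>k b\<close> is well defined and injective.\<close>

lemma prime_index_quotient_isomorphic: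
  assumes p: "Factorial_Ring.prime p" and A: "submodule A \<Z> M" "multiples M p \<subseteq> A"
    and t: "t \<in> carrier M" "t \<notin> A" "carrier M = A <+>\<^bsub>M\<^esub> cyclic_submodule M t"
    and b: "b \<in> torsion_by M (int p)" "b \<noteq> \<zero>"
  shows "module_isomorphic \<Z> (quotient_module M A) (M\<lparr>carrier := cyclic_submodule M b\<rparr>)"
proof -
  let ?Q = "quotient_module M A"
  have bM: "b \<in> carrier M" "int p \<odot> b = \<zero>" using b by (auto simp: torsion_by_def)
  have cancel: "(k - l) \<odot> x = \<zero> \<longleftrightarrow> k \<odot> x = l \<odot> x" if "x \<in> carrier M" for k l x
    using that smult_add[of x "k - l" l] M.add.r_cancel_one[of "l \<odot> x" "(k - l) \<odot> x"] by auto
  have dvd_b: "k \<odot> b = \<zero> \<longleftrightarrow> int p dvd k" for k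
  proof
    show "int p dvd k" if "k \<odot> b = \<zero>"
      using submodule_coprime[OF submodule_trivial bM(1) coprime_primeI[OF p]] that bM(2) b(2) by blast
    show "k \<odot> b = \<zero>" if "int p dvd k"
      using that bM by (auto simp: mult.commute[of "int p"] dvd_def simp flip: smult_smult)
  qed
  have dvd_t: "k \<odot> t \<in> A \<longleftrightarrow> int p dvd k" for k
  proof
    have "int p \<odot> t \<in> A" using A(2) t(1) by (auto simp: multiples_def)
    then show "int p dvd k" if "k \<odot> t \<in> A"
      using submodule_coprime[OF A(1) t(1) coprime_primeI[OF p]] that t(2) by blast
    show "k \<odot> t \<in> A" if "int p dvd k"
      using that \<open>int p \<odot> t \<in> A\<close> t submoduleD(5)[OF A(1)]
      by (auto simp: mult.commute[of "int p"] dvd_def simp flip: smult_smult)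
  qed
  have coset_eq: "A +> k \<odot> t = A +> l \<odot> t \<longleftrightarrow> k \<odot> b = l \<odot> b" for k l
  proof -
    have eq: "k \<odot> t = (k - l) \<odot> t \<oplus> l \<odot> t"
      using smult_add[OF t(1), of "k - l" l] by simp
    have "A +> k \<odot> t = A +> l \<odot> t \<longleftrightarrow> (k - l) \<odot> t \<in> A"
      using coset_eq_iff[OF A(1), of "k \<odot> t" "l \<odot> t"] t(1) eq submoduleD(2)[OF A(1)]
      by (metis M.add.r_cancel smult_carrier)
    then show ?thesis using dvd_t dvd_b cancel[OF bM(1)] by simp
  qed
  \<comment> \<open>The chosen \<open>k\<close> is determined only modulo \<open>p\<close>; by
    \<open>coset_eq\<close> the value \<open>k b\<close> does not depend on the choice.\<close>
  define f where "f U = (SOME k. U = A +> k \<odot> t) \<odot> b" for U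
  have f: "f (A +> k \<odot> t) = k \<odot> b" for k
    unfolding f_def by (rule someI2[of _ k]) (auto simp: coset_eq)
  \<comment> \<open>As \<open>M = A + \<Z>t\<close>, every coset is represented by a multiple of
    \<open>t\<close>.\<close>
  have Q: "carrier ?Q = range (\<lambda>k. A +> k \<odot> t)"
  proof -
    have "\<exists>k. A +> x = A +> k \<odot> t" if x: "x \<in> carrier M" for x
    proof -
      obtain a k where "a \<in> A" "x = a \<oplus> k \<odot> t"
        using x unfolding t(3) mem_set_add_iff cyclic_submodule_def by blast
      then show ?thesis using coset_eq_iff[OF A(1) x, of "k \<odot> t"] t(1) by auto
    qed
    moreover have "carrier ?Q = (\<lambda>x. A +> x) ` carrier M"
      by (auto simp: quotient_module_def A_RCOSETS_def')
    ultimately show ?thesis using t(1) by (fastforce simp: image_iff)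
  qed
  have "f \<in> hom (add_monoid ?Q) (add_monoid (M\<lparr>carrier := cyclic_submodule M b\<rparr>))"
  proof (rule homI)
    show "f U \<in> carrier (add_monoid (M\<lparr>carrier := cyclic_submodule M b\<rparr>))" if "U \<in> carrier (add_monoid ?Q)" for U
      using that f by (auto simp: Q cyclic_submodule_def)
    fix U V assume "U \<in> carrier (add_monoid ?Q)" "V \<in> carrier (add_monoid ?Q)"
    then obtain k l where "U = A +> k \<odot> t" "V = A +> l \<odot> t" by (auto simp: Q)
    moreover have "A +> k \<odot> t <+>\<^bsub>M\<^esub> (A +> l \<odot> t) = A +> (k + l) \<odot> t"
      using coset_add[OF A(1)] t(1) by (simp add: smult_add)
    ultimately show "f (U \<otimes>\<^bsub>add_monoid ?Q\<^esub> V) = f U \<otimes>\<^bsub>add_monoid (M\<lparr>carrier := cyclic_submodule M b\<rparr>)\<^esub> f V"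
      using f bM(1) by (simp add: quotient_module_def smult_add)
  qed
  moreover have "f (k \<odot>\<^bsub>?Q\<^esub> U) = k \<odot> f U" if "U \<in> carrier ?Q" for k U
  proof -
    obtain l where "U = A +> l \<odot> t" using \<open>U \<in> carrier ?Q\<close> by (auto simp: Q)
    then show ?thesis
      using quotient_smult[OF module_axioms A(1), of k "l \<odot> t"] t(1) bM(1) f by (simp add: smult_smult)
  qed
  moreover have "bij_betw f (carrier ?Q) (cyclic_submodule M b)"
    unfolding bij_betw_def
  proof
    show "inj_on f (carrier ?Q)" using f coset_eq by (auto simp: Q inj_on_def)
    show "f ` carrier ?Q = cyclic_submodule M b" using f by (auto simp: Q cyclic_submodule_def image_iff)
  qed
  ultimately show ?thesis
    unfolding module_isomorphic_def module_hom_def by (intro bexI[of _ f]) auto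
qed

section \<open>A primewise criterion for simple-direct-projectivity\<close>

text \<open>If both alternatives fail at \<open>p\<close>, witnesses \<open>b\<close> and
  \<open>t\<close> of the failures give a simple summand \<open>\<Z>b\<close> and a hyperplane
  \<open>A\<close> over \<open>M[p] + pM\<close> with \<open>M/A\<close> isomorphic to
  \<open>\<Z>b\<close>, but \<open>A\<close> has no complement. Conversely, a simple summand of
  exponent \<open>p\<close> excludes the first alternative, and the second yields an element of
  \<open>M[p]\<close> outside \<open>A\<close>, which spans a complement of
  \<open>A\<close>.\<close>

lemma simple_direct_projective_iff:
  "simple_direct_projective \<Z> M \<longleftrightarrow>
    (\<forall>p. Factorial_Ring.prime p \<longrightarrow>
      torsion_by M (int p) \<subseteq> multiples M p \<or>
      carrier M \<subseteq> torsion_by M (int p) <+>\<^bsub>M\<^esub> multiples M p)"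
proof (intro iffI allI impI)
  fix p :: nat assume p: "Factorial_Ring.prime p" and sdp: "simple_direct_projective \<Z> M"
  let ?H = "torsion_by M (int p) <+>\<^bsub>M\<^esub> multiples M p"
  note H = submodule_set_add[OF submodule_torsion_by[of "int p"] submodule_multiples[of p]]
    and le = submodule_subset_set_add[OF submodule_torsion_by[of "int p"] submodule_multiples[of p]]
  show "torsion_by M (int p) \<subseteq> multiples M p \<or> carrier M \<subseteq> ?H"
  proof (rule ccontr)
    assume "\<not> ?thesis"
    then obtain b t where b: "b \<in> torsion_by M (int p)" "b \<notin> multiples M p"
      and t: "t \<in> carrier M" "t \<notin> ?H" by blast
    have "b \<noteq> \<zero>" using b(2) submoduleD(3)[OF submodule_multiples] by blast
    obtain A where A: "submodule A \<Z> M" "?H \<subseteq> A" "t \<notin> A"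
      "carrier M = A <+>\<^bsub>M\<^esub> cyclic_submodule M t" "maximal_submodule A \<Z> M"
      using prime_index_submodule_avoiding[OF p H le(2) t] .
    have "multiples M p \<subseteq> A" using A(2) le by blast
    then have "direct_summand A \<Z> M"
      using sdp A(1) cyclic_simple[OF p b(1) \<open>b \<noteq> \<zero>\<close>] direct_summand_cyclic[OF p b]
        prime_index_quotient_isomorphic[OF p A(1) _ t(1) A(3,4) b(1) \<open>b \<noteq> \<zero>\<close>]
      unfolding simple_direct_projective_def by blast
    then obtain C where C: "submodule C \<Z> M" "A <+>\<^bsub>M\<^esub> C = carrier M" "A \<inter> C = {\<zero>}"
      by (auto simp: direct_summand_def)
    \<comment> \<open>For \<open>c\<close> in the complement, \<open>p c\<close> lies in
      \<open>A \<inter> C = 0\<close>, so \<open>c \<in> M[p] \<subseteq> A\<close>. A complement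
      inside \<open>A\<close> would force \<open>A = M\<close>, contrary to
      \<open>t \<notin> A\<close>.\<close>
    have "C \<subseteq> A"
    proof
      fix c assume c: "c \<in> C"
      then have "int p \<odot> c \<in> A \<inter> C"
        using \<open>multiples M p \<subseteq> A\<close> submoduleD(2,5)[OF C(1)] by (auto simp: multiples_def)
      then have "c \<in> torsion_by M (int p)"
        using C(3) c submoduleD(2)[OF C(1)] by (auto simp: torsion_by_def)
      then show "c \<in> A" using A(2) le by blast
    qed
    then have "carrier M \<subseteq> A" using set_add_subset[OF A(1) subset_refl] C(2) by blast
    then show False using A(3) t(1) by blast
  qed
next
  assume *: "\<forall>p. Factorial_Ring.prime p \<longrightarrow>
      torsion_by M (int p) \<subseteq> multiples M p \<or>
      carrier M \<subseteq> torsion_by M (int p) <+>\<^bsub>M\<^esub> multiples M p"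
  show "simple_direct_projective \<Z> M"
    unfolding simple_direct_projective_def
  proof (intro allI impI, elim conjE)
    fix A B assume A: "submodule A \<Z> M" and B: "simple_submodule B \<Z> M" "direct_summand B \<Z> M"
      and iso: "module_isomorphic \<Z> (quotient_module M A) (M\<lparr>carrier := B\<rparr>)"
    have BM: "submodule B \<Z> M" using B by (simp add: simple_submodule_def)
    obtain p where p: "Factorial_Ring.prime p" "B \<subseteq> torsion_by M (int p)"
      using simple_killed_by_prime[OF B(1)] .
    obtain b where b: "b \<in> B" "b \<noteq> \<zero>" using simple_nonzero[OF B(1)] .
    \<comment> \<open>A nonzero element of a summand of exponent \<open>p\<close> is not in
      \<open>pM\<close>, so only the second alternative remains at this prime.\<close>
    then have "b \<notin> multiples M p" using direct_summand_Int_multiples[OF B(2) p(2)] by blast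
    then have sum: "carrier M \<subseteq> torsion_by M (int p) <+>\<^bsub>M\<^esub> multiples M p" using * p b by blast
    obtain h where lift: "\<forall>x\<in>carrier M. h x \<in> B"
      "\<forall>x\<in>carrier M. \<forall>y\<in>carrier M. h (x \<oplus> y) = h x \<oplus> h y"
      "\<forall>k. \<forall>x\<in>carrier M. h (k \<odot> x) = k \<odot> h x"
      "\<forall>x\<in>carrier M. h x = \<zero> \<longleftrightarrow> x \<in> A"
      "B = h ` carrier M"
      using quotient_isomorphism_lift[OF A BM iso] .
    note h = lift[rule_format]
    \<comment> \<open>\<open>h (p y) = p (h y) = 0\<close>, since \<open>B\<close> is killed by
      \<open>p\<close>.\<close>
    have "int p \<odot> y \<in> A" if y: "y \<in> carrier M" for y
      using h(1)[OF y] h(3)[OF y, of "int p"] h(4)[of "int p \<odot> y"] p(2) y by (auto simp: torsion_by_def)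
    then have "multiples M p \<subseteq> A" by (auto simp: multiples_def)
    moreover have "\<not> carrier M \<subseteq> A" using h(4,5) b by blast
    \<comment> \<open>Otherwise \<open>A\<close> would contain \<open>M[p] + pM = M\<close>.\<close>
    ultimately have "\<not> torsion_by M (int p) \<subseteq> A"
      using set_add_subset[OF A] sum by blast
    then obtain x where x: "x \<in> torsion_by M (int p)" "x \<notin> A" by blast
    then have xM: "x \<in> carrier M" by (simp add: torsion_by_def)
    have "y \<in> A <+>\<^bsub>M\<^esub> cyclic_submodule M x" if y: "y \<in> carrier M" for y
    proof -
      \<comment> \<open>As \<open>x \<notin> A\<close>, \<open>h x\<close> is nonzero and generates
        \<open>B\<close>. From \<open>h y = k (h x)\<close> it follows that \<open>y - k x\<close>
        lies in the kernel \<open>A\<close>.\<close>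
      have "h y \<in> cyclic_submodule M (h x)"
        using simple_eq_cyclic[OF B(1) h(1)[OF xM]] h(1)[OF y] h(4)[OF xM] x(2) by blast
      then obtain k where k: "h y = k \<odot> h x" by (auto simp: cyclic_submodule_def)
      have hx: "h x \<in> carrier M" using h(1)[OF xM] submoduleD(2)[OF BM] by blast
      have "h (y \<oplus> (- k) \<odot> x) = (k + - k) \<odot> h x"
        using h(2,3) y xM k hx by (simp only: smult_add smult_carrier)
      then have "y \<oplus> (- k) \<odot> x \<in> A" using h(4) y xM hx by simp
      moreover have "y = (y \<oplus> (- k) \<odot> x) \<oplus> k \<odot> x"
        using y xM smult_add[OF xM, of "- k" k] by (simp add: M.a_assoc)
      ultimately show ?thesis unfolding mem_set_add_iff cyclic_submodule_def by blast
    qed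
    then have "A <+>\<^bsub>M\<^esub> cyclic_submodule M x = carrier M"
      using submoduleD(1)[OF submodule_set_add[OF A submodule_cyclic[OF xM]]] by blast
    then show "direct_summand A \<Z> M"
      using A submodule_cyclic[OF xM] cyclic_Int_trivial[OF p(1) x(1) A x(2)]
      unfolding direct_summand_def by blast
  qed
qed

section \<open>Socle and radical of a \<open>p\<close>-primary group\<close>

text \<open>A simple submodule is killed by some prime \<open>q\<close>. Its elements are also
  killed by powers of \<open>p\<close>, so \<open>q = p\<close>. Conversely, each nonzero element of
  \<open>M[p]\<close> generates a simple submodule.\<close>

lemma socle_primary:
  assumes p: "Factorial_Ring.prime p" and prim: "\<And>x. x \<in> carrier M \<Longrightarrow> \<exists>n. (int p ^ n) \<odot> x = \<zero>"
  shows "socle \<Z> M = torsion_by M (int p)"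
proof
  have simple: "B \<subseteq> torsion_by M (int p)" if B: "simple_submodule B \<Z> M" for B
  proof -
    obtain q where q: "Factorial_Ring.prime q" "B \<subseteq> torsion_by M (int q)"
      using simple_killed_by_prime[OF B] .
    obtain b where b: "b \<in> B" "b \<noteq> \<zero>" using simple_nonzero[OF B] .
    then have bM: "b \<in> carrier M" "int q \<odot> b = \<zero>" using q by (auto simp: torsion_by_def)
    obtain n where n: "(int p ^ n) \<odot> b = \<zero>" using prim bM by blast
    have "p = q"
    proof (rule ccontr)
      assume "p \<noteq> q"
      then have "coprime (int p ^ n) (int q)"
        using primes_coprime[OF p q(1)] by simp
      then show False
        using submodule_coprime[OF submodule_trivial bM(1)] n bM(2) b(2) by blast
    qed
    with q show ?thesis by simp
  qed
  have "finsum M f F \<in> torsion_by M (int p)"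
    if "finite F" "F \<subseteq> {B. simple_submodule B \<Z> M}" "\<forall>B\<in>F. f B \<in> B" for f F
    using that
  proof (induction F)
    case (insert B F)
    then have "\<forall>C\<in>insert B F. f C \<in> torsion_by M (int p)" using simple by blast
    then have "f \<in> F \<rightarrow> carrier M" "f B \<in> carrier M" by (auto simp: torsion_by_def)
    moreover have "f B \<in> torsion_by M (int p)" using insert simple by blast
    ultimately show ?case
      using insert submoduleD(4)[OF submodule_torsion_by] by simp
  qed (simp add: submoduleD(3)[OF submodule_torsion_by])
  then show "socle \<Z> M \<subseteq> torsion_by M (int p)"
    by (auto simp: socle_def sum_of_submodules_def)
  show "torsion_by M (int p) \<subseteq> socle \<Z> M"
  proof
    fix b assume b: "b \<in> torsion_by M (int p)"
    then have bM: "b \<in> carrier M" by (simp add: torsion_by_def)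
    show "b \<in> socle \<Z> M"
    proof (cases "b = \<zero>")
      case True
      then show ?thesis
        by (auto simp: socle_def sum_of_submodules_def intro!: exI[of _ "{}"])
    next
      case False
      let ?F = "{cyclic_submodule M b}"
      have "b = finsum M (\<lambda>_. b) ?F" using bM by simp
      then show ?thesis
        unfolding socle_def sum_of_submodules_def
        using cyclic_simple[OF p b False] mem_cyclic[OF bM] by blast
    qed
  qed
qed

text \<open>Hyperplanes over \<open>pM\<close> are maximal and separate points from
  \<open>pM\<close>, so the radical lies in \<open>pM\<close>. A maximal submodule contains
  \<open>pM\<close> because scalars \<open>1 - k p\<close> act invertibly on a
  \<open>p\<close>-primary group.\<close>

lemma jacobson_radical_primary:
  assumes p: "Factorial_Ring.prime p" and prim: "\<And>x. x \<in> carrier M \<Longrightarrow> \<exists>n. (int p ^ n) \<odot> x = \<zero>"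
  shows "jacobson_radical \<Z> M = multiples M p"
proof
  show "jacobson_radical \<Z> M \<subseteq> multiples M p"
  proof
    fix t assume t: "t \<in> jacobson_radical \<Z> M"
    show "t \<in> multiples M p"
    proof (rule ccontr)
      assume "t \<notin> multiples M p"
      moreover have "t \<in> carrier M" using t by (simp add: jacobson_radical_def)
      ultimately obtain N where "submodule N \<Z> M" "multiples M p \<subseteq> N" "t \<notin> N"
        "carrier M = N <+>\<^bsub>M\<^esub> cyclic_submodule M t" "maximal_submodule N \<Z> M"
        using prime_index_submodule_avoiding[OF p submodule_multiples subset_refl] by metis
      then show False using t by (auto simp: jacobson_radical_def)
    qed
  qed
  have "int p \<odot> x \<in> N" if N: "maximal_submodule N \<Z> M" and x: "x \<in> carrier M" for N x
  proof (rule ccontr)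
    let ?y = "int p \<odot> x"
    assume y: "?y \<notin> N"
    have NM: "submodule N \<Z> M" using N by (simp add: maximal_submodule_def)
    have cyc: "submodule (cyclic_submodule M ?y) \<Z> M" using submodule_cyclic x by simp
    have "N <+>\<^bsub>M\<^esub> cyclic_submodule M ?y = carrier M"
      using N submodule_set_add[OF NM cyc] submodule_subset_set_add[OF NM cyc] y mem_cyclic[of ?y] x
      unfolding maximal_submodule_def by blast
    then have "x \<in> N <+>\<^bsub>M\<^esub> cyclic_submodule M ?y" using x by simp
    then obtain a k where a: "a \<in> N" "x = a \<oplus> k \<odot> ?y"
      by (auto simp: mem_set_add_iff cyclic_submodule_def)
    then have aM: "a \<in> carrier M" using submoduleD(2)[OF NM] by blast
    \<comment> \<open>Solving \<open>x = a + k p x\<close> for \<open>a\<close> puts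
      \<open>(1 - k p) x\<close> into \<open>N\<close>. Since \<open>1 - k p\<close> is coprime to
      the power of \<open>p\<close> killing \<open>x\<close>, also \<open>x \<in> N\<close>,
      contradicting \<open>p x \<notin> N\<close>.\<close>
    have "(1 - k * int p) \<odot> x = x \<oplus> (- (k * int p)) \<odot> x"
      using smult_add[OF x, of 1 "- (k * int p)"] x by simp
    also have "\<dots> = (a \<oplus> (k * int p) \<odot> x) \<oplus> (- (k * int p)) \<odot> x"
      using a x smult_smult[OF x, of k "int p"] by simp
    also have "\<dots> = a"
      using aM x smult_add[OF x, of "k * int p" "- (k * int p)"] by (simp add: M.a_assoc)
    finally have "(1 - k * int p) \<odot> x \<in> N" using a by simp
    moreover obtain n where "(int p ^ n) \<odot> x = \<zero>" using prim[OF x] by blast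
    moreover have "coprime (1 - k * int p) (int p ^ n)"
    proof -
      have "\<not> int p dvd 1 - k * int p"
      proof
        assume "int p dvd 1 - k * int p"
        then have "int p dvd (1 - k * int p) + k * int p" by (intro dvd_add) auto
        then show False using prime_gt_1_nat[OF p] by simp
      qed
      then show ?thesis using coprime_primeI[OF p] by simp
    qed
    ultimately have "x \<in> N"
      using submodule_coprime[OF NM x] submoduleD(3)[OF NM] by metis
    then show False using y submoduleD(5)[OF NM] by blast
  qed
  then show "multiples M p \<subseteq> jacobson_radical \<Z> M"
    by (auto simp: multiples_def jacobson_radical_def)
qed

section \<open>The torsion subgroup and its primary components\<close>

text \<open>Makes the results of the locale available for \<open>torsion M\<close> and
  \<open>primary_component M p\<close>.\<close>

lemma int_module_submodule: "submodule H \<Z> M \<Longrightarrow> int_module (M\<lparr>carrier := H\<rparr>)"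
  by (intro int_module.intro submodule.submodule_is_module module_axioms)

lemma submodule_primary_component: "submodule (primary_component M p) \<Z> M"
proof (rule int_submoduleI)
  note T = submoduleD[OF torsion_submodule[OF module_axioms]]
  show "primary_component M p \<subseteq> carrier M" using T by (auto simp: primary_component_def)
  show "\<zero> \<in> primary_component M p" using T by (auto simp: primary_component_def)
  show "x \<oplus> y \<in> primary_component M p" if xy: "x \<in> primary_component M p" "y \<in> primary_component M p" for x y
  proof -
    obtain m n where mn: "m \<ge> 1" "(int p ^ m) \<odot> x = \<zero>" "(int p ^ n) \<odot> y = \<zero>"
      using xy by (auto simp: primary_component_def)
    have xyT: "x \<in> torsion M" "y \<in> torsion M" using xy by (auto simp: primary_component_def)
    then have "x \<in> carrier M" "y \<in> carrier M" using T by auto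
    \<comment> \<open>\<open>m + n\<close> serves as a common exponent, and \<open>m \<ge> 1\<close>
      keeps it positive.\<close>
    then have "(int p ^ (m + n)) \<odot> (x \<oplus> y) = \<zero>"
      using mn(2,3) smult_smult[of x "int p ^ n" "int p ^ m", symmetric]
        smult_smult[of y "int p ^ m" "int p ^ n", symmetric]
      by (simp only: smult_add_right power_add mult.commute[of "int p ^ n"] smult_zero M.l_zero M.zero_closed)
    then show ?thesis using T(4)[OF xyT] mn(1) by (auto simp: primary_component_def intro!: exI[of _ "m + n"])
  qed
  show "k \<odot> x \<in> primary_component M p" if mem: "x \<in> primary_component M p" for k x
  proof -
    obtain n where n: "n \<ge> 1" "(int p ^ n) \<odot> x = \<zero>" using mem by (auto simp: primary_component_def)
    have x: "x \<in> torsion M" using mem by (auto simp: primary_component_def)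
    then have "(int p ^ n) \<odot> (k \<odot> x) = \<zero>"
      using T(2)[OF x] n(2) smult_smult[of x k "int p ^ n"] smult_smult[of x "int p ^ n" k]
      by (simp add: mult.commute)
    then show ?thesis using n(1) T(5)[OF x] by (auto simp: primary_component_def)
  qed
qed

lemma torsion_by_subset_torsion: "n \<noteq> 0 \<Longrightarrow> torsion_by M n \<subseteq> torsion M"
  by (auto simp: torsion_by_def torsion_def)

text \<open>\<open>M/T\<close> is torsion-free: if a nonzero \<open>m\<close> kills
  \<open>n x\<close>, then the nonzero \<open>m n\<close> kills \<open>x\<close>.\<close>

lemma torsion_if_smult_torsion:
  assumes "n \<noteq> 0" "x \<in> carrier M" "n \<odot> x \<in> torsion M"
  shows "x \<in> torsion M"
proof -
  obtain m where "m \<noteq> 0" "(m * n) \<odot> x = \<zero>"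
    using assms by (auto simp: torsion_def smult_smult)
  then show ?thesis using assms by (auto simp: torsion_def intro!: exI[of _ "m * n"])
qed

lemma torsion_by_torsion:
  assumes "n \<noteq> 0"
  shows "torsion_by (M\<lparr>carrier := torsion M\<rparr>) n = torsion_by M n"
  using assms by (auto simp: torsion_by_def torsion_def)

text \<open>Purity of the torsion subgroup: if \<open>p x\<close> is torsion, so is
  \<open>x\<close>.\<close>

lemma multiples_torsion:
  assumes "p \<noteq> 0"
  shows "multiples (M\<lparr>carrier := torsion M\<rparr>) p = multiples M p \<inter> torsion M"
proof -
  note T = submoduleD(2,5)[OF torsion_submodule[OF module_axioms]]
  have "int p \<odot> x \<in> torsion M \<longleftrightarrow> x \<in> torsion M" if "x \<in> carrier M" for x
    using torsion_if_smult_torsion[OF _ that, of "int p"] assms T(2)[of x "int p"] by (simp, blast)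
  then have "(\<lambda>x. int p \<odot> x) ` torsion M = (\<lambda>x. int p \<odot> x) ` carrier M \<inter> torsion M"
    using T(1) by (simp add: set_eq_iff image_iff Bex_def) metis
  then show ?thesis by (simp add: multiples_def)
qed

text \<open>Socle and radical of \<open>T\<^sub>p\<close> are \<open>M[p]\<close> and
  \<open>pT\<^sub>p\<close>. If \<open>b \<in> M[p]\<close> equals \<open>p x\<close> with
  \<open>x\<close> in \<open>M\<close>, then \<open>p\<^sup>2 x = 0\<close>, so \<open>x\<close> is
  already in \<open>T\<^sub>p\<close>; thus divisibility of \<open>b\<close> by \<open>p\<close> may
  be tested in \<open>M\<close>.\<close>

lemma socle_subset_radical_primary_iff:
  assumes p: "Factorial_Ring.prime p"
  defines "P \<equiv> M\<lparr>carrier := primary_component M p\<rparr>"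
  shows "socle \<Z> P \<subseteq> jacobson_radical \<Z> P \<longleftrightarrow> torsion_by M (int p) \<subseteq> multiples M p"
proof -
  interpret P: int_module P
    unfolding P_def by (rule int_module_submodule[OF submodule_primary_component])
  have p0: "int p \<noteq> 0" using prime_gt_0_nat[OF p] by simp
  have prim: "\<exists>n. (int p ^ n) \<odot>\<^bsub>P\<^esub> x = \<zero>\<^bsub>P\<^esub>" if "x \<in> carrier P" for x
    using that by (auto simp: P_def primary_component_def)
  have mem: "x \<in> primary_component M p" if "x \<in> carrier M" "(int p ^ n) \<odot> x = \<zero>" "n \<ge> 1" for x n
    using that p0 unfolding primary_component_def torsion_def by (auto intro!: exI[of _ "int p ^ n"])
  have "torsion_by P (int p) = torsion_by M (int p)"
    using mem[of _ 1] submoduleD(2)[OF submodule_primary_component] by (auto simp: P_def torsion_by_def)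
  moreover have "torsion_by M (int p) \<subseteq> multiples P p \<longleftrightarrow> torsion_by M (int p) \<subseteq> multiples M p"
  proof
    show "torsion_by M (int p) \<subseteq> multiples M p" if "torsion_by M (int p) \<subseteq> multiples P p"
    proof -
      have "multiples P p \<subseteq> multiples M p"
        using submoduleD(2)[OF submodule_primary_component] by (auto simp: P_def multiples_def)
      with that show ?thesis by blast
    qed
    show "torsion_by M (int p) \<subseteq> multiples P p" if le: "torsion_by M (int p) \<subseteq> multiples M p"
    proof
      fix b assume b: "b \<in> torsion_by M (int p)"
      then obtain x where x: "x \<in> carrier M" "b = int p \<odot> x" using le by (auto simp: multiples_def)
      then have "(int p ^ 2) \<odot> x = \<zero>"
        using b by (simp add: torsion_by_def smult_smult power2_eq_square)
      then have "x \<in> primary_component M p" using mem[of x 2] x by simp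
      then show "b \<in> multiples P p" using x by (auto simp: P_def multiples_def)
    qed
  qed
  ultimately show ?thesis
    using P.socle_primary[OF p prim] P.jacobson_radical_primary[OF p prim] by simp
qed

end

section \<open>Comparison of the criteria for \<open>M\<close> and its torsion subgroup\<close>

theorem theorem1:
  fixes M :: "(int, 'a, 'm) module_scheme"
  assumes "Module.module \<Z> M"
  shows "simple_direct_projective \<Z> M \<longleftrightarrow>
    (simple_direct_projective \<Z> (M\<lparr>carrier := torsion M\<rparr>) \<and>
     (\<forall>p::nat. Factorial_Ring.prime p \<and> multiples M p <+>\<^bsub>M\<^esub> torsion M \<noteq> carrier M \<longrightarrow>
        socle \<Z> (M\<lparr>carrier := primary_component M p\<rparr>)
          \<subseteq> jacobson_radical \<Z> (M\<lparr>carrier := primary_component M p\<rparr>)))"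
proof -
  interpret int_module M using assms by (simp add: int_module_def)
  let ?S = "\<lambda>p. torsion_by M (int p)" and ?pM = "\<lambda>p. multiples M p" and ?T = "torsion M"
  note T = torsion_submodule[OF assms]
  interpret T: int_module "M\<lparr>carrier := ?T\<rparr>" by (rule int_module_submodule[OF T])
  have prime_nz: "p \<noteq> 0" "int p \<noteq> 0" if "Factorial_Ring.prime p" for p :: nat
    using prime_gt_0_nat[OF that] by auto
  have add_eq: "H <+>\<^bsub>M\<lparr>carrier := ?T\<rparr>\<^esub> K = H <+>\<^bsub>M\<^esub> K" for H K
    by (simp add: set_add_def')
  have sdpT: "simple_direct_projective \<Z> (M\<lparr>carrier := ?T\<rparr>) \<longleftrightarrow>
    (\<forall>p. Factorial_Ring.prime p \<longrightarrow> ?S p \<subseteq> ?pM p \<or> ?T \<subseteq> ?S p <+>\<^bsub>M\<^esub> (?pM p \<inter> ?T))"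
  proof -
    \<comment> \<open>As \<open>M[p] \<subseteq> T\<close>, the inclusion of \<open>M[p]\<close> in
      \<open>pT = pM \<inter> T\<close> amounts to its inclusion in \<open>pM\<close>.\<close>
    have "torsion_by (M\<lparr>carrier := ?T\<rparr>) (int p) = ?S p" "multiples (M\<lparr>carrier := ?T\<rparr>) p = ?pM p \<inter> ?T"
      "?S p \<subseteq> ?T" if "Factorial_Ring.prime p" for p
      using torsion_by_torsion multiples_torsion torsion_by_subset_torsion prime_nz[OF that] by auto
    then show ?thesis
      unfolding T.simple_direct_projective_iff add_eq by (simp cong: imp_cong)
  qed
  have sub: "?pM p <+>\<^bsub>M\<^esub> ?T \<subseteq> carrier M" for p
    using submoduleD(1)[OF submodule_set_add[OF submodule_multiples T]] .
  have comm: "?S p <+>\<^bsub>M\<^esub> ?pM p = ?pM p <+>\<^bsub>M\<^esub> ?S p" for p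
    by (rule set_add_commute) (auto simp: submoduleD(1)[OF submodule_torsion_by] submoduleD(1)[OF submodule_multiples])
  \<comment> \<open>The equivalence holds prime by prime: the conjuncts on the right are the
    criterion for \<open>T\<close> and condition (b) at \<open>p\<close>.\<close>
  have "(?S p \<subseteq> ?pM p \<or> carrier M \<subseteq> ?S p <+>\<^bsub>M\<^esub> ?pM p) \<longleftrightarrow>
    (?S p \<subseteq> ?pM p \<or> ?T \<subseteq> ?S p <+>\<^bsub>M\<^esub> (?pM p \<inter> ?T)) \<and>
    (?pM p <+>\<^bsub>M\<^esub> ?T \<noteq> carrier M \<longrightarrow> ?S p \<subseteq> ?pM p)" (is "?L \<longleftrightarrow> ?R")
    if p: "Factorial_Ring.prime p" for p
  proof
    have ST: "?S p \<subseteq> ?T" using torsion_by_subset_torsion prime_nz[OF p] by simp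
    have sumS: "submodule (?S p <+>\<^bsub>M\<^esub> ?pM p) \<Z> M"
      by (rule submodule_set_add[OF submodule_torsion_by submodule_multiples])
    note leS = submodule_subset_set_add[OF submodule_torsion_by[of "int p"] submodule_multiples[of p]]
    note leT = submodule_subset_set_add[OF submodule_multiples[of p] T]
    show ?R if ?L
    proof (cases "?S p \<subseteq> ?pM p")
      case False
      with that have L: "carrier M \<subseteq> ?S p <+>\<^bsub>M\<^esub> ?pM p" by blast
      \<comment> \<open>Decompose a torsion \<open>x = s + y\<close> with
        \<open>s \<in> M[p]\<close> and \<open>y \<in> pM\<close>; then \<open>y = x - s\<close> is
        torsion as well.\<close>
      have "?T \<subseteq> ?S p <+>\<^bsub>M\<^esub> (?pM p \<inter> ?T)"
      proof
        fix x assume x: "x \<in> ?T"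
        then obtain s y where s: "s \<in> ?S p" "y \<in> ?pM p" "x = s \<oplus>\<^bsub>M\<^esub> y"
          using L submoduleD(2)[OF T] unfolding mem_set_add_iff[symmetric] by (meson mem_set_add_iff subsetD)
        then have "y \<in> ?T"
          using submodule_add_cancel[OF T] x ST submoduleD(2)[OF submodule_multiples] by blast
        with s show "x \<in> ?S p <+>\<^bsub>M\<^esub> (?pM p \<inter> ?T)" by (auto simp: mem_set_add_iff)
      qed
      \<comment> \<open>\<open>M[p] \<subseteq> T\<close> turns \<open>M = M[p] + pM\<close> into
        \<open>M = pM + T\<close>, so condition (b) is vacuous at \<open>p\<close>.\<close>
      moreover have "?S p <+>\<^bsub>M\<^esub> ?pM p \<subseteq> ?pM p <+>\<^bsub>M\<^esub> ?T"
        using set_add_subset[OF submodule_set_add[OF submodule_multiples T]] ST leT by blast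
      ultimately show ?thesis using L sub by blast
    qed auto
    show ?L if ?R
    proof (cases "?S p \<subseteq> ?pM p")
      case False
      \<comment> \<open>When \<open>M[p]\<close> is not inside \<open>pM\<close>, (b) forces
        \<open>pM + T = M\<close>. Since \<open>T \<subseteq> M[p] + pM\<close>, this gives
        \<open>M = M[p] + pM\<close>.\<close>
      with that have "?T \<subseteq> ?S p <+>\<^bsub>M\<^esub> (?pM p \<inter> ?T)" "?pM p <+>\<^bsub>M\<^esub> ?T = carrier M" by auto
      moreover have "?S p <+>\<^bsub>M\<^esub> (?pM p \<inter> ?T) \<subseteq> ?S p <+>\<^bsub>M\<^esub> ?pM p"
        by (rule subsetI, unfold mem_set_add_iff) blast
      ultimately show ?thesis using set_add_subset[OF sumS leS(2), of ?T] by blast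
    qed auto
  qed
  then show ?thesis
    unfolding simple_direct_projective_iff sdpT using socle_subset_radical_primary_iff by blast
qed

end
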